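(* Suppose that for all $u\in U$ the matrix $\nabla_x^2 f(x^*(u),u)$ is positive definite, and that the map $D(\nabla_x f)$ is Lipschitz continuous on $Z$ with constant $C\ge 0$. Let $u\in U$, $s\in\mathbb R^P$, $r\in\mathbb R^N$, $\beta\in[0,1)$, $0<\alpha\le 2(1+\beta)/L(u)$; let $(x^{(k)})$ be generated by $x^{(k+1)}=x^{(k)}-\alpha\nabla_x f(x^{(k)},u)+\beta(x^{(k)}-x^{(k-1)})$ with $x^{(-1)}=x^{(0)}=a$, and let $K\in\mathbb N$ be sufficiently large that $x^{(K)}\in B_{\varepsilon(u)}(x^*(u))$. Put $R:=(1+\beta)I-\alpha\nabla_x^2 f(x^{(K)},u)$. Let $(\hat x^{(k)})_{k\in\mathbb N}$ be generated by $$\hat x^{(k+1)}=R\,\hat x^{(k)}-\alpha\nabla_{xu}f(x^{(K)},u)\,s-\beta\,\hat x^{(k-1)},\qquad \hat x^{(-1)}=\hat x^{(0)}=0,$$ and let $(\tilde u^{(K)}_n)_{n\in\mathbb N}$ be generated by $$\tilde u^{(K)}_{n+1}=\tilde u^{(K)}_n-\alpha\,\tilde x^{(K-n)}\nabla_{xu}f(x^{(K)},u),\qquad \tilde x^{(K-n-1)}=\tilde x^{(K-n)}R-\beta\,\tilde x^{(K-n+1)},$$ with $\tilde u^{(K)}_0=0$, $\tilde x^{(K)}=r^T$ and $\tilde x^{(K+1)}=0$. Then $\hat x^{(k)}\to\varphi(x^{(K)},u)s$ as $k\to\infty$ and $\tilde u_n^{(K)}\to r^T\varphi(x^{(K)},u)$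 as $n\to\infty$. In particular, there exists $q_{HB}\in[0,1)$ such that for all $\gamma>0$ there exists $c$ such that for all $k,n\in\mathbb N$, $$\|\hat x^{(k)}-\varphi(x^{(K)},u)s\|\le c\,(q_{HB}+\gamma)^{k}\,\frac{\kappa}{m(u)}\|s\|\quad\text{and}\quad \|\tilde u^{(K)}_n-r^T\varphi(x^{(K)},u)\|\le c\,(q_{HB}+\gamma)^{n}\,\frac{\kappa}{m(u)}\|r\| .$$
   Context: Let $N,P\in\mathbb N$, let $U\subset\mathbb R^P$ be open, non-empty and bounded, and let $f:\mathbb R^N\times\mathbb R^P\to\mathbb R$ be twice continuously differentiable on $\mathbb R^N\times U$. For every $u\in U$ the function $f(\cdot,u)$ is convex and has a unique minimizer over $\mathbb R^N$, denoted $x^*(u)$. $\nabla_x f$ is the gradient in $x$, $\nabla_x^2 f$ the $N\times N$ Hessian in $x$, $\nabla_{xu}f$ the $N\times P$ matrix of derivatives of $\nabla_x f$ with respect to $u$, and $D(\nabla_x f)$ the total derivative of $\nabla_x f$ with respect to $(x,u)$. Norms are Euclidean norms and the induced operator norms. Positive definiteness of $\nabla_x^2 f(x^*(u),u)$ gives, for each $u\in U$, numbers $\varepsilon(u)>0$ and $m(u)>0$ such that $f(\cdot,u)$ is $m(u)$-strongly convex on the closed ball $B_{\varepsilon(u)}(x^*(u))$; these are fixed. A point $a\in\mathbb R^N$ is fixed such that for every $u\in U$ the (bounded) level set $X(u):=\{x\in\mathbb R^N: f(x,u)\le f(a,u)\}$ contains $B_{\varepsilon(u)}(x^*(u))$.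 Set $Z:=\{(x,u)\in\mathbb R^N\times U: x\in X(u)\}$. $L(u)>0$ is an upper bound on the maximum eigenvalue of $\nabla_x^2 f(x,u)$ over $x\in X(u)$. $\kappa>0$ is an upper bound for $\|\nabla_{xu}f(x,u)\|$ over $(x,u)\in Z$. For $u\in U$ and $x\in B_{\varepsilon(u)}(x^*(u))$, $$\varphi(x,u):=-\nabla_x^2 f(x,u)^{-1}\nabla_{xu}f(x,u)\in\mathbb R^{N\times P}.$$ The index $K-n$ of the row vectors $\tilde x^{(K-n)}$ may become negative (the recursion is continued for all $n\in\mathbb N$ with $x^{(K)}$ fixed).
   Formalization: At the endpoint α = 2(1+β)/L(u) it is additionally assumed that L(u) is not an eigenvalue of ∇_x²f(x^(K),u); otherwise the recursions can oscillate, e.g. f = |x−u|²/2, L = 1, β = 0, α = 2 gives 0, 2s, 0, 2s, …. *)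

theory Defs
  imports "HOL-Analysis.Analysis"
begin

text \<open>Twice continuously differentiable on a set \<open>S\<close>, which is intended to be open (the
  derivatives are taken in the whole space).\<close>

definition C2_on :: "('a::real_normed_vector \<Rightarrow> 'b::real_normed_vector) \<Rightarrow> 'a set \<Rightarrow> bool" where
  "C2_on f S \<longleftrightarrow>
    (\<exists>(f' :: 'a \<Rightarrow> 'a \<Rightarrow>\<^sub>L 'b) (f'' :: 'a \<Rightarrow> 'a \<Rightarrow>\<^sub>L ('a \<Rightarrow>\<^sub>L 'b)).
       (\<forall>z\<in>S. (f has_derivative blinfun_apply (f' z)) (at z)) \<and>
       (\<forall>z\<in>S. (f' has_derivative blinfun_apply (f'' z)) (at z)) \<and>
       continuous_on S f'')"

definition strongly_convex_on :: "'a::real_normed_vector set \<Rightarrow> ('a \<Rightarrow> real) \<Rightarrow> real \<Rightarrow> bool" where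
  "strongly_convex_on S g m \<longleftrightarrow> convex S \<and>
    (\<forall>x\<in>S. \<forall>y\<in>S. \<forall>t\<in>{0..1}.
       g (t *\<^sub>R x + (1 - t) *\<^sub>R y)
         \<le> t * g x + (1 - t) * g y - m / 2 * t * (1 - t) * (norm (x - y))\<^sup>2)"

text \<open>Symmetry is not part of the definition; the Hessians it is used for are symmetric.\<close>

definition positive_definite :: "real^'n^'n \<Rightarrow> bool" where
  "positive_definite A \<longleftrightarrow> (\<forall>v. v \<noteq> 0 \<longrightarrow> v \<bullet> (A *v v) > 0)"

text \<open>In the theorem the step size may equal \<open>2 * (1 + \<beta>) / L u\<close>, but then \<open>L u\<close> must not be an
  eigenvalue of the Hessian at the iterate of index \<open>K\<close>. If it were, \<open>-1\<close> would be a root of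
  \<open>z\<^sup>2 - (1 + \<beta> - \<alpha> * L u) * z + \<beta>\<close> and the recursions need not converge: for
  \<open>f (x, u) = (x - u)\<^sup>2 / 2\<close>, \<open>L u = 1\<close>, \<open>\<alpha> = 2\<close>, \<open>\<beta> = 0\<close>, \<open>K = 0\<close> one gets
  \<open>0, 2 * s, 0, 2 * s, \<dots>\<close> in place of convergence to \<open>s\<close>.\<close>

definition is_eigenvalue :: "real^'n^'n \<Rightarrow> real \<Rightarrow> bool" where
  "is_eigenvalue A l \<longleftrightarrow> (\<exists>v. v \<noteq> 0 \<and> A *v v = l *\<^sub>R v)"

definition grad_x :: "((real^'n) \<times> (real^'p) \<Rightarrow> real) \<Rightarrow> real^'n \<Rightarrow> real^'p \<Rightarrow> real^'n" where
  "grad_x f x u = (\<chi> i. frechet_derivative (\<lambda>y. f (y, u)) (at x) (axis i 1))"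

definition hess_x :: "((real^'n) \<times> (real^'p) \<Rightarrow> real) \<Rightarrow> real^'n \<Rightarrow> real^'p \<Rightarrow> real^'n^'n" where
  "hess_x f x u = jacobian (\<lambda>y. grad_x f y u) (at x)"

definition grad_xu :: "((real^'n) \<times> (real^'p) \<Rightarrow> real) \<Rightarrow> real^'n \<Rightarrow> real^'p \<Rightarrow> real^'p^'n" where
  "grad_xu f x u = jacobian (\<lambda>v. grad_x f x v) (at u)"

text \<open>The total derivative of \<open>(x, u) \<mapsto> grad_x f x u\<close>, with the operator norm of bounded linear
  maps; the product type carries the Euclidean norm.\<close>

definition D_grad_x ::
    "((real^'n) \<times> (real^'p) \<Rightarrow> real) \<Rightarrow> (real^'n) \<times> (real^'p) \<Rightarrow> ((real^'n) \<times> (real^'p)) \<Rightarrow>\<^sub>L (real^'n)" where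
  "D_grad_x f z = Blinfun (frechet_derivative (\<lambda>(y, v). grad_x f y v) (at z))"

definition minimizer :: "((real^'n) \<times> (real^'p) \<Rightarrow> real) \<Rightarrow> real^'p \<Rightarrow> real^'n" where
  "minimizer f u = arg_min (\<lambda>x. f (x, u)) (\<lambda>_. True)"

definition level_set :: "((real^'n) \<times> (real^'p) \<Rightarrow> real) \<Rightarrow> real^'n \<Rightarrow> real^'p \<Rightarrow> (real^'n) set" where
  "level_set f a u = {x. f (x, u) \<le> f (a, u)}"

definition level_graph ::
    "((real^'n) \<times> (real^'p) \<Rightarrow> real) \<Rightarrow> real^'n \<Rightarrow> (real^'p) set \<Rightarrow> ((real^'n) \<times> (real^'p)) set" where
  "level_graph f a U = {(x, u). u \<in> U \<and> x \<in> level_set f a u}"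

definition phi :: "((real^'n) \<times> (real^'p) \<Rightarrow> real) \<Rightarrow> real^'n \<Rightarrow> real^'p \<Rightarrow> real^'p^'n" where
  "phi f x u = - (matrix_inv (hess_x f x u) ** grad_xu f x u)"

end

theory Submission
  imports Defs
begin

text \<open>With \<open>H\<close> the Hessian at the iterate of index \<open>K\<close>, both recursions are heavy-ball iterations for linear
  systems with matrix \<open>H\<close>, and their errors satisfy \<open>e (k + 2) = R (e (k + 1)) - \<beta> e k\<close> with
  \<open>R = (1 + \<beta>) I - \<alpha> H\<close>. As \<open>H\<close> is symmetric, \<open>H \<ge> m\<close> by strong convexity, and \<open>\<alpha> H < 2 (1 + \<beta>)\<close> by the
  eigenvalue bound, the operator norm of \<open>R\<close> is smaller than \<open>1 + \<beta>\<close>. Instead of diagonalising \<open>R\<close>, a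
  quadratic Lyapunov function gives the geometric decay of \<open>e\<close>.\<close>

section \<open>Geometric decay of the homogeneous heavy-ball recursion\<close>

text \<open>\<open>W\<close> is the Schur--Cohn form of \<open>z\<^sup>2 - R z + \<beta>\<close>, up to the factor \<open>1 - \<beta>\<close>.\<close>

lemma heavy_ball_lyapunov_step:
  fixes e :: "nat \<Rightarrow> 'a::real_inner"
  assumes sym: "\<And>v w. R v \<bullet> w = v \<bullet> R w"
    and step: "\<And>k. e (Suc (Suc k)) = R (e (Suc k)) - \<beta> *\<^sub>R e k"
    and W: "\<And>k. W k = (1 + \<beta>) * ((norm (e k))\<^sup>2 + (norm (e (Suc k)))\<^sup>2) - 2 * (R (e (Suc k)) \<bullet> e k)"
  shows "W (Suc k) = W k - (1 - \<beta>) * (norm (e (Suc (Suc k)) - e k))\<^sup>2"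
proof -
  define x y z where "x = e k" and "y = e (Suc k)" and "z = e (Suc (Suc k))"
  have Ry: "R y = z + \<beta> *\<^sub>R x"
    using step[of k] by (simp add: x_def y_def z_def)
  \<comment> \<open>By symmetry both values of \<open>W\<close> involve \<open>R\<close> only
    through \<open>R y\<close>, which the recursion eliminates; what remains is an identity between
    inner products of \<open>x\<close>, \<open>y\<close>, \<open>z\<close>.\<close>
  have "R z \<bullet> y = R y \<bullet> z"
    using sym[of z y] by (simp add: inner_commute)
  then have "W (Suc k) = (1 + \<beta>) * (y \<bullet> y + z \<bullet> z) - 2 * ((z + \<beta> *\<^sub>R x) \<bullet> z)"
    by (simp add: W Ry flip: x_def y_def z_def power2_norm_eq_inner)
  moreover have "W k = (1 + \<beta>) * (x \<bullet> x + y \<bullet> y) - 2 * ((z + \<beta> *\<^sub>R x) \<bullet> x)"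
    by (simp add: W Ry flip: x_def y_def z_def power2_norm_eq_inner)
  ultimately show ?thesis
    unfolding power2_norm_eq_inner
    by (simp add: inner_add_left inner_diff_left inner_diff_right inner_commute algebra_simps
        flip: x_def y_def z_def)
qed

text \<open>One step may leave \<open>W\<close> unchanged, namely if \<open>e (k + 2) = e k\<close>. This cannot happen twice in a row
  unless \<open>e = 0\<close>, so \<open>W\<close> contracts along two steps.\<close>

lemma heavy_ball_geometric_decay:
  fixes R :: "'a::real_inner \<Rightarrow> 'a"
  assumes R: "linear R" and sym: "\<And>v w. R v \<bullet> w = v \<bullet> R w"
    and \<rho>: "0 \<le> \<rho>" "\<rho> < 1 + \<beta>" and bound: "\<And>v. norm (R v) \<le> \<rho> * norm v"
    and \<beta>: "0 \<le> \<beta>" "\<beta> < 1"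
  obtains q c :: real where "0 \<le> q" "q < 1" "0 \<le> c"
    and "\<And>e k. (\<And>k. e (Suc (Suc k)) = R (e (Suc k)) - \<beta> *\<^sub>R e k) \<Longrightarrow>
           norm (e k) \<le> c * q ^ k * (norm (e 0) + norm (e (Suc 0)))"
proof -
  define \<delta> where "\<delta> = 1 + \<beta> - \<rho>"
  \<comment> \<open>\<open>72 = 18 * 4\<close>: the 18 bounds a square in \<open>two_step\<close>,
    the 4 is the constant of \<open>upper\<close>. The two-step contraction factor of
    \<open>W\<close> is \<open>1 - 1 / M\<close>, so \<open>t\<close> is the factor per step for
    \<open>W\<close> and \<open>sqrt t\<close> the one for the norm.\<close>
  define M where "M = 72 / (\<delta>\<^sup>2 * (1 - \<beta>))"
  define t where "t = sqrt (1 - 1 / M)"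
  have \<delta>: "0 < \<delta>" "\<delta> < 2"
    using \<rho> \<beta> by (auto simp: \<delta>_def)
  \<comment> \<open>This leads to \<open>M > 1\<close>, so that \<open>t\<close> is positive and may
    be divided by.\<close>
  have "\<delta>\<^sup>2 < 2\<^sup>2"
    using \<delta> by (intro power_strict_mono) auto
  then have "\<delta>\<^sup>2 * (1 - \<beta>) \<le> 4 * 1"
    using \<beta> by (intro mult_mono) auto
  moreover have pos: "0 < \<delta>\<^sup>2 * (1 - \<beta>)"
    using \<delta> \<beta> by simp
  ultimately have M: "1 < M"
    by (simp add: M_def less_divide_eq)
  then have t: "0 < t" "t < 1" and tsq: "t\<^sup>2 = 1 - 1 / M"
    by (auto simp: t_def)
  have main: "norm (e k) \<le> sqrt (4 / (t * \<delta>)) * sqrt t ^ k * (norm (e 0) + norm (e (Suc 0)))"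
    if step: "\<And>k. e (Suc (Suc k)) = R (e (Suc k)) - \<beta> *\<^sub>R e k" for e k
  proof -
    define N where "N k = (norm (e k))\<^sup>2 + (norm (e (Suc k)))\<^sup>2" for k
    define W where "W k = (1 + \<beta>) * N k - 2 * (R (e (Suc k)) \<bullet> e k)" for k
    define D where "D k = (norm (e (Suc (Suc k)) - e k))\<^sup>2" for k
    have W_Suc: "W (Suc k) = W k - (1 - \<beta>) * D k" for k
      unfolding D_def
      by (rule heavy_ball_lyapunov_step[of R e, OF sym step]) (simp add: W_def N_def)
    have cross: "\<bar>2 * (R (e (Suc k)) \<bullet> e k)\<bar> \<le> \<rho> * N k" for k
    proof -
      have "\<bar>R (e (Suc k)) \<bullet> e k\<bar> \<le> norm (R (e (Suc k))) * norm (e k)"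
        by (rule Cauchy_Schwarz_ineq2)
      also have "\<dots> \<le> \<rho> * norm (e (Suc k)) * norm (e k)"
        using bound by (intro mult_right_mono) auto
      finally have "\<bar>2 * (R (e (Suc k)) \<bullet> e k)\<bar> \<le> \<rho> * (2 * norm (e k) * norm (e (Suc k)))"
        by (simp add: mult_ac)
      also have "\<dots> \<le> \<rho> * N k"
        using \<rho>(1) sum_squares_bound[of "norm (e k)" "norm (e (Suc k))"]
        by (intro mult_left_mono) (auto simp: N_def)
      finally show ?thesis .
    qed
    have N_nonneg: "0 \<le> N k" for k
      by (simp add: N_def)
    have lower: "\<delta> * N k \<le> W k" for k
      using cross[of k] by (simp add: W_def \<delta>_def algebra_simps)
    have upper: "W k \<le> 4 * N k" for k
    proof -
      have "W k \<le> (1 + \<beta> + \<rho>) * N k"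
        using cross[of k] by (simp add: W_def algebra_simps)
      also have "\<dots> \<le> 4 * N k"
        using \<beta> \<rho> N_nonneg by (intro mult_right_mono) auto
      finally show ?thesis .
    qed
    have W_nonneg: "0 \<le> W k" for k
      using lower[of k] N_nonneg[of k] \<delta>(1) by (meson mult_nonneg_nonneg less_imp_le order_trans)
    have two_step: "W (Suc (Suc k)) \<le> t\<^sup>2 * W k" for k
    proof -
      \<comment> \<open>If \<open>d1\<close> and \<open>d2\<close> were both zero,
        \<open>(1 + \<beta>) e k = R (e (k + 1))\<close> and
        \<open>(1 + \<beta>) e (k + 1) = R (e k)\<close> would hold, which forces
        \<open>e k = e (k + 1) = 0\<close> because \<open>\<rho> < 1 + \<beta>\<close>. The
        estimates below make this quantitative, with the gap \<open>\<delta>\<close>.\<close>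
      define d1 d2 where "d1 = e (Suc (Suc k)) - e k" and "d2 = e (Suc (Suc (Suc k))) - e (Suc k)"
      have *: "(1 + \<beta>) *\<^sub>R e k = R (e (Suc k)) - d1"
        using step[of k] by (simp add: d1_def algebra_simps)
      have "R (e (Suc (Suc k))) = R (e k) + R d1"
        unfolding d1_def by (simp add: linear_diff[OF R])
      then have **: "(1 + \<beta>) *\<^sub>R e (Suc k) = R (e k) + R d1 - d2"
        using step[of "Suc k"] by (simp add: d2_def algebra_simps)
      have "(1 + \<beta>) * norm (e k) = norm (R (e (Suc k)) - d1)"
        using \<beta> arg_cong[OF *, of norm] by simp
      also have "\<dots> \<le> \<rho> * norm (e (Suc k)) + norm d1"
        using norm_triangle_ineq4[of "R (e (Suc k))" d1] bound[of "e (Suc k)"] by linarith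
      finally have 1: "(1 + \<beta>) * norm (e k) \<le> \<rho> * norm (e (Suc k)) + norm d1" .
      have "(1 + \<beta>) * norm (e (Suc k)) = norm (R (e k) + R d1 - d2)"
        using \<beta> arg_cong[OF **, of norm] by simp
      also have "\<dots> \<le> \<rho> * norm (e k) + \<rho> * norm d1 + norm d2"
        using norm_triangle_ineq4[of "R (e k) + R d1" d2] norm_triangle_ineq[of "R (e k)" "R d1"]
          bound[of "e k"] bound[of d1] by linarith
      also have "\<rho> * norm d1 \<le> 2 * norm d1"
        using \<rho> \<beta> by (intro mult_right_mono) auto
      finally have 2: "(1 + \<beta>) * norm (e (Suc k)) \<le> \<rho> * norm (e k) + 2 * norm d1 + norm d2"
        by simp
      have "\<delta> * (norm (e k) + norm (e (Suc k))) \<le> 3 * norm d1 + norm d2"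
        using 1 2 by (simp add: \<delta>_def algebra_simps)
      then have "(\<delta> * (norm (e k) + norm (e (Suc k))))\<^sup>2 \<le> (3 * norm d1 + norm d2)\<^sup>2"
        using \<delta> by (intro power_mono) auto
      \<comment> \<open>Cauchy-Schwarz would give 10 in place of 18; the larger constant is
        harmless.\<close>
      also have "\<dots> \<le> 18 * ((norm d1)\<^sup>2 + (norm d2)\<^sup>2)"
      proof -
        have "18 * ((norm d1)\<^sup>2 + (norm d2)\<^sup>2) - (3 * norm d1 + norm d2)\<^sup>2
            = (norm d1 - 3 * norm d2)\<^sup>2 + 8 * (norm d1)\<^sup>2 + 8 * (norm d2)\<^sup>2"
          by (simp add: power2_eq_square algebra_simps)
        moreover have "0 \<le> (norm d1 - 3 * norm d2)\<^sup>2 + 8 * (norm d1)\<^sup>2 + 8 * (norm d2)\<^sup>2"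
          by simp
        ultimately show ?thesis
          by linarith
      qed
      finally have "\<delta>\<^sup>2 * (norm (e k) + norm (e (Suc k)))\<^sup>2 \<le> 18 * (D k + D (Suc k))"
        by (simp add: D_def d1_def d2_def power_mult_distrib)
      moreover have "\<delta>\<^sup>2 * N k \<le> \<delta>\<^sup>2 * (norm (e k) + norm (e (Suc k)))\<^sup>2"
        by (intro mult_left_mono) (auto simp: N_def power2_sum)
      ultimately have "\<delta>\<^sup>2 * N k \<le> 18 * (D k + D (Suc k))"
        by linarith
      moreover have "\<delta>\<^sup>2 * W k \<le> \<delta>\<^sup>2 * (4 * N k)"
        using upper by (intro mult_left_mono) auto
      ultimately have "\<delta>\<^sup>2 * W k \<le> 72 * (D k + D (Suc k))"
        by linarith
      then have "(1 - \<beta>) * (\<delta>\<^sup>2 * W k) \<le> (1 - \<beta>) * (72 * (D k + D (Suc k)))"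
        using \<beta> by (intro mult_left_mono) auto
      \<comment> \<open>The losses of two consecutive steps telescope.\<close>
      also have "\<dots> = 72 * (W k - W (Suc (Suc k)))"
        by (simp add: W_Suc algebra_simps)
      finally have "W k / M \<le> W k - W (Suc (Suc k))"
        by (simp add: M_def field_simps)
      then show ?thesis
        by (simp add: tsq algebra_simps)
    qed
    \<comment> \<open>The contraction covers two steps at a time, so even and odd indices start
      separately. The factor \<open>1 / t\<close> pays for index 1, where only
      \<open>W 1 \<le> W 0\<close> is known.\<close>
    have W_decay: "W k \<le> t ^ k * (W 0 / t)" for k
    proof (induction k rule: induct_nat_012)
      case 0
      have "t * W 0 \<le> 1 * W 0"
        using t W_nonneg by (intro mult_right_mono) auto
      then show ?case
        using t by (simp add: field_simps)
    next
      case 1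
      have "0 \<le> (1 - \<beta>) * D 0"
        using \<beta> by (simp add: D_def)
      then show ?case
        using W_Suc[of 0] t by simp
    next
      case (ge2 k)
      have "W (Suc (Suc k)) \<le> t\<^sup>2 * W k"
        by (rule two_step)
      also have "\<dots> \<le> t\<^sup>2 * (t ^ k * (W 0 / t))"
        by (intro mult_left_mono ge2) auto
      finally show ?case
        by (simp only: power_Suc power2_eq_square mult.assoc)
    qed
    have "\<delta> * (norm (e k))\<^sup>2 \<le> \<delta> * N k"
      using \<delta> by (intro mult_left_mono) (auto simp: N_def)
    also have "\<dots> \<le> t ^ k * (W 0 / t)"
      using lower[of k] W_decay[of k] by linarith
    also have "\<dots> \<le> t ^ k * (4 * (norm (e 0) + norm (e (Suc 0)))\<^sup>2 / t)"
    proof -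
      have "N 0 \<le> (norm (e 0) + norm (e (Suc 0)))\<^sup>2"
        by (simp add: N_def power2_sum)
      then have "W 0 \<le> 4 * (norm (e 0) + norm (e (Suc 0)))\<^sup>2"
        using upper[of 0] by linarith
      then show ?thesis
        using t by (intro mult_left_mono divide_right_mono) auto
    qed
    finally have "(norm (e k))\<^sup>2 \<le> 4 / (t * \<delta>) * t ^ k * (norm (e 0) + norm (e (Suc 0)))\<^sup>2"
      using \<delta> t by (simp add: field_simps)
    also have "\<dots> = (sqrt (4 / (t * \<delta>)) * sqrt t ^ k * (norm (e 0) + norm (e (Suc 0))))\<^sup>2"
    proof -
      have "(sqrt t ^ k)\<^sup>2 = t ^ k"
        using t by (metis less_imp_le power_commutes power_mult real_sqrt_pow2 mult.commute)
      moreover have "(sqrt (4 / (t * \<delta>)))\<^sup>2 = 4 / (t * \<delta>)"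
        using t \<delta> by (intro real_sqrt_pow2) auto
      ultimately show ?thesis
        by (simp only: power_mult_distrib)
    qed
    finally show ?thesis
      by (rule power2_le_imp_le) (use t \<delta> in auto)
  qed
  show thesis
    by (rule that[of "sqrt t" "sqrt (4 / (t * \<delta>))", OF _ _ _ main]) (use t \<delta> in auto)
qed

section \<open>Operator norm of a symmetric map from its eigenvalues\<close>

text \<open>At a unit vector \<open>v\<close> maximising \<open>norm (R v)\<close>, with maximum
  \<rho>, the equality case of Cauchy-Schwarz gives \<open>R (R v) = \<rho>\<^sup>2 v\<close>. Since
  this says that \<open>R - \<rho>\<close> annihilates \<open>R v + \<rho> v\<close>, either that
  vector is an eigenvector for \<rho>, or it vanishes and \<open>v\<close> is one for
  -\<rho>.\<close>

lemma symmetric_operator_norm_less: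
  fixes R :: "'a::euclidean_space \<Rightarrow> 'a"
  assumes R: "linear R" and sym: "\<And>v w. R v \<bullet> w = v \<bullet> R w"
    and eig: "\<And>l v. v \<noteq> 0 \<Longrightarrow> R v = l *\<^sub>R v \<Longrightarrow> \<bar>l\<bar> < B"
  obtains \<rho> where "0 \<le> \<rho>" "\<rho> < B" "\<And>v. norm (R v) \<le> \<rho> * norm v"
proof -
  have "continuous_on (sphere 0 1) (\<lambda>v. norm (R v))"
    using R by (intro continuous_intros linear_continuous_on) (simp add: linear_conv_bounded_linear)
  moreover have "sphere 0 1 \<noteq> ({} :: 'a set)"
    by simp
  ultimately obtain v where v: "norm v = 1" and sup: "\<And>w. norm w = 1 \<Longrightarrow> norm (R w) \<le> norm (R v)"
    using continuous_attains_sup[OF compact_sphere] by (metis mem_sphere_0)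
  define \<rho> where "\<rho> = norm (R v)"
  have bound: "norm (R w) \<le> \<rho> * norm w" for w
  proof (cases "w = 0")
    case False
    then have "norm (R (w /\<^sub>R norm w)) \<le> \<rho>"
      unfolding \<rho>_def by (intro sup) simp
    then show ?thesis
      using False by (simp add: linear_scale[OF R] field_simps)
  qed (simp add: linear_0[OF R])
  have RRv: "R (R v) = \<rho>\<^sup>2 *\<^sub>R v"
  proof -
    have "norm (R (R v)) \<le> \<rho> * \<rho>"
      using bound[of "R v"] by (simp add: \<rho>_def)
    then have "(norm (R (R v)))\<^sup>2 \<le> (\<rho> * \<rho>)\<^sup>2"
      by (intro power_mono) auto
    moreover have "R (R v) \<bullet> v = \<rho>\<^sup>2"
      using sym[of "R v" v] by (simp add: \<rho>_def power2_norm_eq_inner)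
    \<comment> \<open>With the two facts above and \<open>norm v = 1\<close> the right-hand side is
      at most \<open>\<rho>^4 - 2 \<rho>^4 + \<rho>^4 = 0\<close>.\<close>
    moreover have "(norm (R (R v) - \<rho>\<^sup>2 *\<^sub>R v))\<^sup>2
        = (norm (R (R v)))\<^sup>2 - 2 * \<rho>\<^sup>2 * (R (R v) \<bullet> v) + \<rho>\<^sup>2 * \<rho>\<^sup>2 * (norm v)\<^sup>2"
      unfolding power2_norm_eq_inner by (simp add: inner_diff_left inner_diff_right inner_commute)
    ultimately have "(norm (R (R v) - \<rho>\<^sup>2 *\<^sub>R v))\<^sup>2 \<le> 0"
      using v by (simp add: power2_eq_square)
    then show ?thesis
      by simp
  qed
  define w where "w = R v + \<rho> *\<^sub>R v"
  have "\<rho> < B"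
  proof (cases "w = 0")
    case True
    then have "R v = (- \<rho>) *\<^sub>R v"
      by (simp add: w_def eq_neg_iff_add_eq_0)
    moreover have "v \<noteq> 0"
      using v by auto
    ultimately show ?thesis
      using eig[of v "- \<rho>"] by simp
  next
    case False
    have "R w = \<rho> *\<^sub>R w"
      by (simp add: w_def linear_add[OF R] linear_scale[OF R] RRv power2_eq_square algebra_simps)
    then show ?thesis
      using eig[OF False] by fastforce
  qed
  moreover have "0 \<le> \<rho>"
    by (simp add: \<rho>_def)
  ultimately show thesis
    using that bound by blast
qed

section \<open>Hessians: symmetry and the lower bound from strong convexity\<close>

text \<open>The mean value theorem in direction \<open>w\<close>, applied to the increment in
  direction \<open>v\<close>, reduces the second difference to a difference of gradients, which is
  expanded to first order around \<open>x\<close>. Differentiability of \<open>G\<close> at the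
  single point \<open>x\<close> suffices.\<close>

lemma second_difference_approx:
  fixes G :: "'a::real_inner \<Rightarrow> 'a"
  assumes g: "\<And>y. (g has_derivative (\<lambda>h. G y \<bullet> h)) (at y)"
    and H: "(G has_derivative H) (at x)" and "e > 0"
  shows "eventually (\<lambda>t. \<bar>g (x + t *\<^sub>R v + t *\<^sub>R w) - g (x + t *\<^sub>R w) - g (x + t *\<^sub>R v) + g x - t\<^sup>2 * (H v \<bullet> w)\<bar>
           \<le> e * t\<^sup>2) (at_right 0)"
proof -
  interpret H: bounded_linear H
    using H by (rule has_derivative_bounded_linear)
  \<comment> \<open>The summand 1 keeps \<open>r\<close> positive when \<open>v = w = 0\<close>. The
    constant \<open>e'\<close> is chosen so that the final error
    \<open>t * (2 * e' * (t * r) * r)\<close> is exactly \<open>e * t\<^sup>2\<close>.\<close>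
  define r where "r = norm v + norm w + 1"
  define e' where "e' = e / (2 * r * r)"
  have r: "r > 0"
    by (simp add: r_def add_nonneg_pos)
  then have e': "e' > 0"
    using \<open>e > 0\<close> by (simp add: e'_def)
  then obtain d where "d > 0"
    and d: "\<And>y. norm (y - x) < d \<Longrightarrow> norm (G y - G x - H (y - x)) \<le> e' * norm (y - x)"
    using H unfolding has_derivative_at_alt by blast
  have "\<bar>g (x + t *\<^sub>R v + t *\<^sub>R w) - g (x + t *\<^sub>R w) - g (x + t *\<^sub>R v) + g x - t\<^sup>2 * (H v \<bullet> w)\<bar> \<le> e * t\<^sup>2"
    if t: "0 < t" "t < d / r" for t
  proof -
    have approx: "norm (G (x + h) - G x - H h) \<le> e' * (t * r)" if "norm h \<le> t * r" for h
    proof -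
      have "norm h < d"
        using that t(2) r by (simp add: field_simps)
      then have "norm (G (x + h) - G x - H h) \<le> e' * norm h"
        using d[of "x + h"] by simp
      also have "\<dots> \<le> e' * (t * r)"
        using that e' by simp
      finally show ?thesis .
    qed
    define \<phi> where "\<phi> s = g (x + t *\<^sub>R v + s *\<^sub>R w) - g (x + s *\<^sub>R w)" for s
    have line: "((\<lambda>s. g (c + s *\<^sub>R w)) has_derivative (\<lambda>h. G (c + s *\<^sub>R w) \<bullet> (h *\<^sub>R w))) (at s)" for c s
      by (rule has_derivative_compose[OF _ g]) (auto intro!: derivative_eq_intros)
    have "(\<phi> has_derivative (\<lambda>h. G (x + t *\<^sub>R v + s *\<^sub>R w) \<bullet> (h *\<^sub>R w) - G (x + s *\<^sub>R w) \<bullet> (h *\<^sub>R w)))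
        (at s within {0..t})" for s
      unfolding \<phi>_def by (rule has_derivative_at_withinI[OF has_derivative_diff[OF line line]])
    from mvt_simple[OF t(1), of \<phi>, OF this] obtain s where s: "s \<in> {0<..<t}"
      and mvt: "\<phi> t - \<phi> 0 = G (x + t *\<^sub>R v + s *\<^sub>R w) \<bullet> ((t - 0) *\<^sub>R w) - G (x + s *\<^sub>R w) \<bullet> ((t - 0) *\<^sub>R w)"
      by auto
    have sw: "norm (s *\<^sub>R w) \<le> t * norm w"
      using s by (auto intro: mult_right_mono)
    have tr: "t * norm v + t * norm w \<le> t * r"
      using t(1) by (simp add: r_def algebra_simps)
    have "0 \<le> t * norm v"
      using t(1) by simp
    then have sw': "norm (s *\<^sub>R w) \<le> t * r"
      using sw tr by linarith
    have "norm (t *\<^sub>R v + s *\<^sub>R w) \<le> t * r"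
      using norm_triangle_ineq[of "t *\<^sub>R v" "s *\<^sub>R w"] sw tr t(1) by simp
    then have 1: "norm (G (x + (t *\<^sub>R v + s *\<^sub>R w)) - G x - H (t *\<^sub>R v + s *\<^sub>R w)) \<le> e' * (t * r)"
      by (rule approx)
    have 2: "norm (G (x + s *\<^sub>R w) - G x - H (s *\<^sub>R w)) \<le> e' * (t * r)"
      by (rule approx[OF sw'])
    define E where "E = G (x + t *\<^sub>R v + s *\<^sub>R w) - G (x + s *\<^sub>R w) - t *\<^sub>R H v"
    \<comment> \<open>Subtracting the two expansions around \<open>x\<close> cancels
      \<open>G x\<close> and the term \<open>s H w\<close>.\<close>
    have "E = (G (x + (t *\<^sub>R v + s *\<^sub>R w)) - G x - H (t *\<^sub>R v + s *\<^sub>R w)) - (G (x + s *\<^sub>R w) - G x - H (s *\<^sub>R w))"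
      by (simp add: E_def H.add H.scaleR add.assoc)
    then have E: "norm E \<le> 2 * e' * (t * r)"
      using 1 2 norm_triangle_ineq4[of "G (x + (t *\<^sub>R v + s *\<^sub>R w)) - G x - H (t *\<^sub>R v + s *\<^sub>R w)"
          "G (x + s *\<^sub>R w) - G x - H (s *\<^sub>R w)"] by simp
    have "g (x + t *\<^sub>R v + t *\<^sub>R w) - g (x + t *\<^sub>R w) - g (x + t *\<^sub>R v) + g x - t\<^sup>2 * (H v \<bullet> w) = t * (E \<bullet> w)"
      using mvt by (simp add: \<phi>_def E_def inner_diff_left power2_eq_square algebra_simps)
    moreover have "\<bar>t * (E \<bullet> w)\<bar> \<le> t * (2 * e' * (t * r) * r)"
    proof -
      have "\<bar>E \<bullet> w\<bar> \<le> norm E * norm w"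
        by (rule Cauchy_Schwarz_ineq2)
      also have "\<dots> \<le> 2 * e' * (t * r) * r"
        using E e' t(1) r by (intro mult_mono) (auto simp: r_def)
      finally show ?thesis
        using t(1) by (simp add: abs_mult)
    qed
    moreover have "t * (2 * e' * (t * r) * r) = e * t\<^sup>2"
      using r by (simp add: e'_def power2_eq_square)
    ultimately show ?thesis
      by simp
  qed
  then show ?thesis
    unfolding eventually_at_right_field using \<open>d > 0\<close> r by (intro exI[of _ "d / r"]) auto
qed

text \<open>The second difference is invariant under swapping \<open>v\<close> and \<open>w\<close>,
  so after division by \<open>t\<^sup>2\<close> its two approximations must agree.\<close>

lemma gradient_derivative_symmetric:
  fixes G :: "'a::real_inner \<Rightarrow> 'a"
  assumes g: "\<And>y. (g has_derivative (\<lambda>h. G y \<bullet> h)) (at y)"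
    and H: "(G has_derivative H) (at x)"
  shows "H v \<bullet> w = v \<bullet> H w"
proof -
  have "\<bar>H v \<bullet> w - H w \<bullet> v\<bar> \<le> 0 + e" if "e > 0" for e
  proof -
    have "e / 2 > 0"
      using that by simp
    note approx = second_difference_approx[OF g H this]
    have "eventually (\<lambda>t::real. \<bar>H v \<bullet> w - H w \<bullet> v\<bar> \<le> e) (at_right 0)"
      using approx[of v w] approx[of w v] eventually_at_right_less
    proof eventually_elim
      case (elim t)
      have "x + t *\<^sub>R w + t *\<^sub>R v = x + t *\<^sub>R v + t *\<^sub>R w"
        by simp
      then have "\<bar>t\<^sup>2 * (H v \<bullet> w) - t\<^sup>2 * (H w \<bullet> v)\<bar> \<le> e * t\<^sup>2"
        using elim(1,2) by (simp only:)
      then have "t\<^sup>2 * \<bar>H v \<bullet> w - H w \<bullet> v\<bar> \<le> t\<^sup>2 * e"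
        by (simp add: abs_mult mult.commute flip: right_diff_distrib left_diff_distrib)
      then show ?case
        using elim(3) by simp
    qed
    then show ?thesis
      by (simp add: eventually_const_iff)
  qed
  then have "\<bar>H v \<bullet> w - H w \<bullet> v\<bar> \<le> 0"
    by (rule field_le_epsilon)
  then show ?thesis
    by (simp add: inner_commute)
qed

text \<open>Strong convexity on the segment from \<open>y\<close> to \<open>x\<close> is divided by
  the parameter \<open>s\<close>, and \<open>s\<close> tends to 0 from the right.\<close>

lemma strongly_convex_on_gradient_ineq:
  fixes g :: "'a::real_inner \<Rightarrow> real"
  assumes sc: "strongly_convex_on S g m" and "x \<in> S" "y \<in> S"
    and g: "(g has_derivative (\<lambda>h. G \<bullet> h)) (at y)"
  shows "G \<bullet> (x - y) \<le> g x - g y - m / 2 * (norm (x - y))\<^sup>2"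
proof -
  have "((\<lambda>s. y + s *\<^sub>R (x - y)) has_derivative (\<lambda>h. h *\<^sub>R (x - y))) (at 0)"
    by (auto intro!: derivative_eq_intros)
  moreover have "(g has_derivative (\<lambda>h. G \<bullet> h)) (at (y + 0 *\<^sub>R (x - y)))"
    using g by simp
  ultimately have "((\<lambda>s. g (y + s *\<^sub>R (x - y))) has_derivative (\<lambda>h. G \<bullet> (h *\<^sub>R (x - y)))) (at 0)"
    by (rule has_derivative_compose)
  then have "((\<lambda>s. g (y + s *\<^sub>R (x - y))) has_real_derivative G \<bullet> (x - y)) (at 0)"
    by (simp add: has_field_derivative_def mult_commute_abs)
  then have "((\<lambda>s. (g (y + s *\<^sub>R (x - y)) - g y) / s) \<longlongrightarrow> G \<bullet> (x - y)) (at 0)"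
    by (simp add: has_field_derivative_iff)
  then have "((\<lambda>s. (g (y + s *\<^sub>R (x - y)) - g y) / s) \<longlongrightarrow> G \<bullet> (x - y)) (at_right 0)"
    by (rule tendsto_mono[OF at_le[OF subset_UNIV]])
  moreover have "((\<lambda>s. g x - g y - m / 2 * (1 - s) * (norm (x - y))\<^sup>2) \<longlongrightarrow>
      g x - g y - m / 2 * (1 - 0) * (norm (x - y))\<^sup>2) (at_right 0)"
    by (intro tendsto_intros)
  moreover have "eventually (\<lambda>s. (g (y + s *\<^sub>R (x - y)) - g y) / s
      \<le> g x - g y - m / 2 * (1 - s) * (norm (x - y))\<^sup>2) (at_right 0)"
  proof -
    have "eventually (\<lambda>s::real. s < 1) (at_right 0)"
      by (auto simp: eventually_at_right_field intro: exI[of _ 1])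
    then show ?thesis
      using eventually_at_right_less
    proof eventually_elim
      case (elim s)
      have "y + s *\<^sub>R (x - y) = s *\<^sub>R x + (1 - s) *\<^sub>R y"
        by (simp add: algebra_simps)
      then have "g (y + s *\<^sub>R (x - y)) \<le> s * g x + (1 - s) * g y - m / 2 * s * (1 - s) * (norm (x - y))\<^sup>2"
        using sc \<open>x \<in> S\<close> \<open>y \<in> S\<close> elim unfolding strongly_convex_on_def by simp
      then have "g (y + s *\<^sub>R (x - y)) - g y \<le> s * (g x - g y - m / 2 * (1 - s) * (norm (x - y))\<^sup>2)"
        by (simp add: algebra_simps)
      then show ?case
        using elim by (simp add: divide_le_eq mult.commute)
    qed
  qed
  ultimately show ?thesis
    using tendsto_le[OF trivial_limit_at_right_real] by fastforce
qed

lemma strongly_convex_on_gradient_mono: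
  fixes g :: "'a::real_inner \<Rightarrow> real"
  assumes sc: "strongly_convex_on S g m" and "x \<in> S" "y \<in> S"
    and g: "\<And>y. (g has_derivative (\<lambda>h. G y \<bullet> h)) (at y)"
  shows "m * (norm (x - y))\<^sup>2 \<le> (G x - G y) \<bullet> (x - y)"
  using strongly_convex_on_gradient_ineq[OF sc \<open>x \<in> S\<close> \<open>y \<in> S\<close> g]
    strongly_convex_on_gradient_ineq[OF sc \<open>y \<in> S\<close> \<open>x \<in> S\<close> g]
  by (simp add: inner_diff_left inner_diff_right norm_minus_commute)

text \<open>Strong monotonicity of the gradient between \<open>x\<close> and \<open>x + t v\<close>,
  divided by \<open>t\<^sup>2\<close>, in the limit. A one-sided condition on \<open>v\<close>
  allows \<open>x\<close> to be a boundary point of \<open>S\<close>.\<close>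

lemma strongly_convex_on_hessian_admissible:
  fixes g :: "'a::real_inner \<Rightarrow> real"
  assumes sc: "strongly_convex_on S g m"
    and g: "\<And>y. (g has_derivative (\<lambda>h. G y \<bullet> h)) (at y)"
    and H: "(G has_derivative H) (at x)"
    and "x \<in> S" and adm: "eventually (\<lambda>t. x + t *\<^sub>R v \<in> S) (at_right 0)"
  shows "m * (norm v)\<^sup>2 \<le> H v \<bullet> v"
proof -
  interpret H: bounded_linear H
    using H by (rule has_derivative_bounded_linear)
  have "((\<lambda>t. x + t *\<^sub>R v) has_derivative (\<lambda>h. h *\<^sub>R v)) (at 0)"
    by (auto intro!: derivative_eq_intros)
  moreover have "(G has_derivative H) (at (x + 0 *\<^sub>R v))"
    using H by simp
  ultimately have "((\<lambda>t. G (x + t *\<^sub>R v)) has_derivative (\<lambda>h. H (h *\<^sub>R v))) (at 0)"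
    by (rule has_derivative_compose)
  then have "((\<lambda>t. G (x + t *\<^sub>R v) \<bullet> v) has_derivative (\<lambda>h. H (h *\<^sub>R v) \<bullet> v)) (at 0)"
    by (rule has_derivative_inner_left)
  then have "((\<lambda>t. G (x + t *\<^sub>R v) \<bullet> v) has_real_derivative H v \<bullet> v) (at 0)"
    by (simp add: has_field_derivative_def H.scaleR mult_commute_abs)
  then have "((\<lambda>t. (G (x + t *\<^sub>R v) \<bullet> v - G x \<bullet> v) / t) \<longlongrightarrow> H v \<bullet> v) (at_right 0)"
    unfolding has_field_derivative_iff by (intro tendsto_mono[OF at_le[of "{0<..}" UNIV]]) auto
  moreover have "eventually (\<lambda>t. m * (norm v)\<^sup>2 \<le> (G (x + t *\<^sub>R v) \<bullet> v - G x \<bullet> v) / t) (at_right 0)"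
    using adm eventually_at_right_less
  proof eventually_elim
    case (elim t)
    have "t * (t * (m * (norm v)\<^sup>2)) \<le> t * ((G (x + t *\<^sub>R v) - G x) \<bullet> v)"
      using strongly_convex_on_gradient_mono[OF sc elim(1) \<open>x \<in> S\<close> g]
      by (simp add: power_mult_distrib power2_eq_square mult_ac)
    then have "t * (m * (norm v)\<^sup>2) \<le> (G (x + t *\<^sub>R v) - G x) \<bullet> v"
      using elim by simp
    then show ?case
      using elim by (simp add: inner_diff_left field_simps)
  qed
  ultimately show ?thesis
    by (rule tendsto_lowerbound) simp
qed

text \<open>The point may lie on the sphere, where only directions pointing inwards are admissible.
  Outward directions follow because the quadratic form is even, and directions orthogonal to
  \<open>c - x\<close> by approximation.\<close>

lemma strongly_convex_on_cball_hessian: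
  fixes g :: "'a::real_inner \<Rightarrow> real"
  assumes sc: "strongly_convex_on (cball c r) g m" and "r > 0"
    and g: "\<And>y. (g has_derivative (\<lambda>h. G y \<bullet> h)) (at y)"
    and H: "(G has_derivative H) (at x)"
    and x: "x \<in> cball c r"
  shows "m * (norm v)\<^sup>2 \<le> H v \<bullet> v"
proof -
  interpret H: bounded_linear H
    using H by (rule has_derivative_bounded_linear)
  define w where "w = c - x"
  have w: "norm w \<le> r"
    using x by (simp add: w_def dist_norm)
  have inward: "m * (norm v)\<^sup>2 \<le> H v \<bullet> v" if "w \<bullet> v > 0 \<or> w = 0" for v
  proof (rule strongly_convex_on_hessian_admissible[OF sc g H x])
    \<comment> \<open>Here \<open>t v - w\<close> is the position of \<open>x + t v\<close> relative
      to the centre. The first alternative serves the centre itself; in the second the point does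
      not move away from the centre.\<close>
    have "eventually (\<lambda>t. (norm (t *\<^sub>R v - w))\<^sup>2 < r\<^sup>2 \<or> (norm (t *\<^sub>R v - w))\<^sup>2 \<le> (norm w)\<^sup>2) (at_right 0)"
    proof (cases "w = 0")
      case True
      have "((\<lambda>t. (norm (t *\<^sub>R v - w))\<^sup>2) \<longlongrightarrow> (norm (0 *\<^sub>R v - w))\<^sup>2) (at_right 0)"
        by (intro tendsto_intros)
      then have "eventually (\<lambda>t. (norm (t *\<^sub>R v - w))\<^sup>2 < r\<^sup>2) (at_right 0)"
        by (rule order_tendstoD(2)) (use True \<open>r > 0\<close> in simp)
      then show ?thesis
        by eventually_elim simp
    next
      case False
      have "((\<lambda>t. t * (v \<bullet> v) - 2 * (w \<bullet> v)) \<longlongrightarrow> 0 * (v \<bullet> v) - 2 * (w \<bullet> v)) (at_right 0)"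
        by (intro tendsto_intros)
      then have "eventually (\<lambda>t. t * (v \<bullet> v) - 2 * (w \<bullet> v) < 0) (at_right 0)"
        using False that by (intro order_tendstoD(2)) auto
      then show ?thesis
        using eventually_at_right_less
      proof eventually_elim
        case (elim t)
        have "t * (t * (v \<bullet> v) - 2 * (w \<bullet> v)) \<le> 0"
          using elim by (simp add: mult_le_0_iff)
        then show ?case
          by (simp add: power2_norm_eq_inner inner_diff_left inner_diff_right inner_commute algebra_simps)
      qed
    qed
    then show "eventually (\<lambda>t. x + t *\<^sub>R v \<in> cball c r) (at_right 0)"
    proof eventually_elim
      case (elim t)
      moreover have "(norm w)\<^sup>2 \<le> r\<^sup>2"
        using w by (intro power_mono) auto
      ultimately have "(norm (t *\<^sub>R v - w))\<^sup>2 \<le> r\<^sup>2"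
        by linarith
      then have "norm (t *\<^sub>R v - w) \<le> r"
        by (rule power2_le_imp_le) (use \<open>r > 0\<close> in simp)
      moreover have "c - (x + t *\<^sub>R v) = w - t *\<^sub>R v"
        by (simp add: w_def)
      ultimately show ?case
        unfolding mem_cball dist_norm by (metis norm_minus_commute)
    qed
  qed
  have nonorth: "m * (norm v)\<^sup>2 \<le> H v \<bullet> v" if "w \<bullet> v \<noteq> 0 \<or> w = 0" for v
  proof (cases "w \<bullet> v < 0")
    case True
    then show ?thesis
      using inward[of "- v"] by (simp add: linear_neg[OF has_derivative_linear[OF H]])
  next
    case False
    then show ?thesis
      using inward[of v] that by fastforce
  qed
  show ?thesis
  proof (cases "w \<bullet> v = 0 \<and> w \<noteq> 0")
    case True
    \<comment> \<open>Tilting \<open>v\<close> towards the centre makes its inner product with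
      \<open>w\<close> equal to \<open>t * (norm w)\<^sup>2\<close>, which is nonzero, so
      \<open>nonorth\<close> applies before the limit.\<close>
    have "((\<lambda>t. H (v + t *\<^sub>R w) \<bullet> (v + t *\<^sub>R w) - m * (norm (v + t *\<^sub>R w))\<^sup>2) \<longlongrightarrow>
        H (v + 0 *\<^sub>R w) \<bullet> (v + 0 *\<^sub>R w) - m * (norm (v + 0 *\<^sub>R w))\<^sup>2) (at_right 0)"
      by (intro tendsto_intros H.tendsto)
    moreover have "eventually (\<lambda>t. 0 \<le> H (v + t *\<^sub>R w) \<bullet> (v + t *\<^sub>R w) - m * (norm (v + t *\<^sub>R w))\<^sup>2) (at_right 0)"
      using eventually_at_right_less
    proof eventually_elim
      case (elim t)
      then have "w \<bullet> (v + t *\<^sub>R w) \<noteq> 0"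
        using True by (simp add: inner_add_right)
      then show ?case
        using nonorth[of "v + t *\<^sub>R w"] by simp
    qed
    ultimately have "0 \<le> H (v + 0 *\<^sub>R w) \<bullet> (v + 0 *\<^sub>R w) - m * (norm (v + 0 *\<^sub>R w))\<^sup>2"
      by (rule tendsto_lowerbound) simp
    then show ?thesis
      by simp
  qed (use nonorth in auto)
qed

section \<open>Gradient and Hessian in \<open>x\<close> as derivatives\<close>

text \<open>Connects the coordinate definitions with Frechet derivatives: the witnesses of
  \<open>C2_on\<close> are composed with the embedding of the slice of constant
  \<open>u\<close>.\<close>

lemma C2_on_grad_x:
  fixes f :: "(real^'n) \<times> (real^'p) \<Rightarrow> real"
  assumes "C2_on f (UNIV \<times> U)" and "u \<in> U"
  shows "((\<lambda>y. f (y, u)) has_derivative (\<lambda>h. grad_x f x u \<bullet> h)) (at x)"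
    and "((\<lambda>y. grad_x f y u) has_derivative (\<lambda>h. hess_x f x u *v h)) (at x)"
proof -
  obtain f' f'' where f': "\<And>y. (f has_derivative blinfun_apply (f' (y, u))) (at (y, u))"
    and f'': "\<And>y. (f' has_derivative blinfun_apply (f'' (y, u))) (at (y, u))"
    using assms unfolding C2_on_def by blast
  have emb: "((\<lambda>y. (y, u)) has_derivative (\<lambda>h. (h, 0))) (at y)" for y :: "real^'n"
    by (auto intro!: derivative_eq_intros)
  have D: "((\<lambda>y. f (y, u)) has_derivative (\<lambda>h. f' (y, u) (h, 0))) (at y)" for y
    by (rule has_derivative_compose[OF emb f'])
  have grad: "grad_x f y u = (\<chi> i. f' (y, u) (axis i 1, 0))" for y
    unfolding grad_x_def by (simp flip: frechet_derivative_at[OF D])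
  have "f' (x, u) (h, 0) = grad_x f x u \<bullet> h" for h
  proof -
    interpret linear "\<lambda>h. f' (x, u) (h, 0)"
      using D by (intro has_derivative_linear)
    have "f' (x, u) (h, 0) = f' (x, u) ((\<Sum>i\<in>UNIV. (h $ i) *\<^sub>R axis i 1), 0)"
      by (simp add: basis_expansion[of h, unfolded scalar_mult_eq_scaleR])
    also have "\<dots> = (\<Sum>i\<in>UNIV. h $ i * f' (x, u) (axis i 1, 0))"
      by (subst sum) (simp add: scale)
    also have "\<dots> = grad_x f x u \<bullet> h"
      by (simp add: grad inner_vec_def mult.commute)
    finally show ?thesis .
  qed
  then show "((\<lambda>y. f (y, u)) has_derivative (\<lambda>h. grad_x f x u \<bullet> h)) (at x)"
    using D[of x] by simp
  have "((\<lambda>y. f' (y, u)) has_derivative (\<lambda>h. f'' (x, u) (h, 0))) (at x)"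
    by (rule has_derivative_compose[OF emb f''])
  then have "((\<lambda>y. f' (y, u) (axis i 1, 0)) has_derivative (\<lambda>h. f'' (x, u) (h, 0) (axis i 1, 0))) (at x)" for i
    by (rule bounded_linear.has_derivative[OF bounded_linear_apply_blinfun])
  then have "((\<lambda>y. grad_x f y u) has_derivative (\<lambda>h. \<chi> i. f'' (x, u) (h, 0) (axis i 1, 0))) (at x)"
    unfolding grad by (subst has_derivative_componentwise_within) (auto simp: Basis_vec_def inner_axis)
  then have "(\<lambda>y. grad_x f y u) differentiable (at x)"
    by (rule differentiableI)
  then show "((\<lambda>y. grad_x f y u) has_derivative (\<lambda>h. hess_x f x u *v h)) (at x)"
    unfolding hess_x_def by (simp add: jacobian_works)
qed

section \<open>Heavy-ball iteration for a linear system\<close>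

text \<open>The solution \<open>p\<close> of \<open>H p = - b\<close> is a fixed point of the
  recursion, so the error is homogeneous. The constants are chosen before \<open>z\<close>,
  \<open>b\<close> and \<open>p\<close>, so that one pair serves both modes. The sequence
  \<open>z\<close> is shifted by one: \<open>z 0\<close> stands for index -1.\<close>

lemma heavy_ball_linear_solver:
  fixes H :: "'a::euclidean_space \<Rightarrow> 'a"
  assumes H: "linear H" and sym: "\<And>v w. H v \<bullet> w = v \<bullet> H w"
    and "m > 0" and coercive: "\<And>v. m * (norm v)\<^sup>2 \<le> H v \<bullet> v"
    and "\<alpha> > 0" and \<beta>: "0 \<le> \<beta>" "\<beta> < 1"
    and eig: "\<And>l v. v \<noteq> 0 \<Longrightarrow> H v = l *\<^sub>R v \<Longrightarrow> \<alpha> * l < 2 * (1 + \<beta>)"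
  obtains q c :: real where "0 \<le> q" "q < 1" "0 \<le> c"
    and "\<And>z b p k. \<lbrakk>\<And>k. z (Suc (Suc k)) = (1 + \<beta>) *\<^sub>R z (Suc k) - \<alpha> *\<^sub>R H (z (Suc k)) - \<alpha> *\<^sub>R b - \<beta> *\<^sub>R z k;
           z 0 = 0; z (Suc 0) = 0; H p = - b\<rbrakk> \<Longrightarrow> norm (z (Suc k) - p) \<le> c * q ^ k * (norm b / m)"
proof -
  interpret H: linear H
    by (rule H)
  define R where "R v = (1 + \<beta>) *\<^sub>R v - \<alpha> *\<^sub>R H v" for v
  have R: "linear R"
    unfolding R_def by (rule linearI) (simp_all add: H.add H.scale algebra_simps)
  have R_sym: "R v \<bullet> w = v \<bullet> R w" for v w
    by (simp add: R_def inner_diff_left inner_diff_right sym)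
  \<comment> \<open>An eigenvalue \<open>l\<close> of \<open>R\<close> comes from the eigenvalue
    \<mu> of \<open>H\<close>. Positivity of \<mu> gives \<open>l < 1 + \<beta>\<close>, the bound
    \<open>eig\<close> gives \<open>l > - (1 + \<beta>)\<close>.\<close>
  have R_eig: "\<bar>l\<bar> < 1 + \<beta>" if "v \<noteq> 0" "R v = l *\<^sub>R v" for l v
  proof -
    define \<mu> where "\<mu> = (1 + \<beta> - l) / \<alpha>"
    have "\<alpha> *\<^sub>R H v = (1 + \<beta> - l) *\<^sub>R v"
      using that(2) by (simp add: R_def algebra_simps)
    then have "\<alpha> *\<^sub>R H v = \<alpha> *\<^sub>R (\<mu> *\<^sub>R v)"
      using \<open>\<alpha> > 0\<close> by (simp add: \<mu>_def)
    then have Hv: "H v = \<mu> *\<^sub>R v"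
      using \<open>\<alpha> > 0\<close> by (metis scaleR_cancel_left less_irrefl)
    have "m * (norm v)\<^sup>2 \<le> \<mu> * (norm v)\<^sup>2"
      using coercive[of v] by (simp add: Hv power2_norm_eq_inner)
    then have "\<mu> > 0"
      using \<open>v \<noteq> 0\<close> \<open>m > 0\<close> by simp
    moreover have "\<alpha> * \<mu> < 2 * (1 + \<beta>)"
      by (rule eig[OF \<open>v \<noteq> 0\<close> Hv])
    moreover have "\<alpha> * \<mu> = 1 + \<beta> - l"
      using \<open>\<alpha> > 0\<close> by (simp add: \<mu>_def)
    ultimately show ?thesis
      using mult_pos_pos[OF \<open>\<alpha> > 0\<close> \<open>\<mu> > 0\<close>] by (simp add: abs_less_iff)
  qed
  obtain \<rho> where \<rho>: "0 \<le> \<rho>" "\<rho> < 1 + \<beta>" "\<And>v. norm (R v) \<le> \<rho> * norm v"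
    by (rule symmetric_operator_norm_less[OF R R_sym]) (use R_eig in blast)+
  obtain q c :: real where q: "0 \<le> q" "q < 1" and c: "0 \<le> c"
    and decay: "\<And>e k. (\<And>k. e (Suc (Suc k)) = R (e (Suc k)) - \<beta> *\<^sub>R e k) \<Longrightarrow>
           norm (e k) \<le> c * q ^ k * (norm (e 0) + norm (e (Suc 0)))"
    by (rule heavy_ball_geometric_decay[OF R R_sym \<rho> \<beta>]) blast
  have "norm (z (Suc k) - p) \<le> 2 * c * q ^ k * (norm b / m)"
    if step: "\<And>k. z (Suc (Suc k)) = (1 + \<beta>) *\<^sub>R z (Suc k) - \<alpha> *\<^sub>R H (z (Suc k)) - \<alpha> *\<^sub>R b - \<beta> *\<^sub>R z k"
      and "z 0 = 0" "z (Suc 0) = 0" and p: "H p = - b" for z b p k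
  proof -
    have "z (Suc (Suc k)) - p = R (z (Suc k) - p) - \<beta> *\<^sub>R (z k - p)" for k
      by (simp add: step R_def H.diff p algebra_simps)
    then have "norm (z (Suc k) - p) \<le> c * q ^ Suc k * (norm (z 0 - p) + norm (z (Suc 0) - p))"
      by (rule decay[where e = "\<lambda>k. z k - p"])
    also have "\<dots> = 2 * c * q ^ Suc k * norm p"
      by (simp add: \<open>z 0 = 0\<close> \<open>z (Suc 0) = 0\<close>)
    \<comment> \<open>The shift provides a spare factor \<open>q\<close>, which is dropped;
      coercivity bounds \<open>p\<close> and is the source of the factor
      \<open>1 / m\<close>.\<close>
    also have "\<dots> \<le> 2 * c * q ^ k * (norm b / m)"
    proof (intro mult_mono)
      show "q ^ Suc k \<le> q ^ k"
        using q by (intro power_decreasing) auto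
      have "m * (norm p)\<^sup>2 \<le> norm b * norm p"
        using coercive[of p] Cauchy_Schwarz_ineq2[of b p] by (simp add: p)
      then have "norm p * m \<le> norm b"
        by (cases "p = 0") (simp_all add: power2_eq_square mult_ac)
      then show "norm p \<le> norm b / m"
        using \<open>m > 0\<close> by (simp add: field_simps)
    qed (use q c in auto)
    finally show ?thesis .
  qed
  then show thesis
    using that[of q "2 * c"] q c by simp
qed

section \<open>Tools for the reverse mode and the inverse Hessian\<close>

text \<open>The transpose has no larger operator norm: pair \<open>y v* A\<close> with itself and
  move \<open>A\<close> to the other side.\<close>

lemma norm_vector_matrix_mult_le:
  fixes A :: "real^'p^'n"
  assumes "onorm ((*v) A) \<le> b"
  shows "norm (y v* A) \<le> b * norm y"
proof -
  define z where "z = y v* A"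
  have "z \<bullet> z = y \<bullet> (A *v z)"
    unfolding z_def by (rule dot_lmul_matrix)
  also have "\<dots> \<le> norm y * norm (A *v z)"
    by (rule norm_cauchy_schwarz)
  also have "\<dots> \<le> norm y * (b * norm z)"
    using onorm[of "(*v) A" z] assms
    by (intro mult_left_mono order_trans[OF onorm] mult_right_mono) auto
  finally have "norm z * norm z \<le> (b * norm y) * norm z"
    by (simp add: power2_norm_eq_inner[symmetric] power2_eq_square mult_ac)
  moreover have "0 \<le> b * norm y"
    using onorm_pos_le[of "(*v) A"] assms by simp
  ultimately show ?thesis
    by (cases "z = 0") (auto simp flip: z_def)
qed

text \<open>Momentum and gradient steps commute with partial summation, so the sums of the reverse-mode
  adjoints run through the forward recursion with right-hand side \<open>r\<close>.\<close>

lemma heavy_ball_partial_sums: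
  fixes w :: "nat \<Rightarrow> 'a::real_vector"
  assumes H: "linear H" and w0: "w 0 = r"
    and w1: "w (Suc 0) = (1 + \<beta>) *\<^sub>R r - \<alpha> *\<^sub>R H r"
    and step: "\<And>n. w (Suc (Suc n)) = (1 + \<beta>) *\<^sub>R w (Suc n) - \<alpha> *\<^sub>R H (w (Suc n)) - \<beta> *\<^sub>R w n"
    and y: "\<And>n. y n = (\<Sum>j<n. - \<alpha> *\<^sub>R w j)"
  shows "y (Suc n) = (1 + \<beta>) *\<^sub>R y n - \<alpha> *\<^sub>R H (y n) - \<alpha> *\<^sub>R r - \<beta> *\<^sub>R y (n - 1)"
proof (induction n rule: induct_nat_012)
  \<comment> \<open>On naturals \<open>0 - 1 = 0\<close>, so the value at index -1 is read as
    \<open>y 0 = 0\<close>, which is the required start.\<close>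
  case 0
  show ?case
    by (simp add: y w0 linear_0[OF H])
next
  case 1
  show ?case
    by (simp add: y w0 w1 linear_scale[OF H] linear_neg[OF H] algebra_simps)
next
  case (ge2 n)
  have y_Suc: "y (Suc k) = y k - \<alpha> *\<^sub>R w k" for k
    by (simp add: y)
  have "y (Suc (Suc (Suc n))) = y (Suc (Suc n)) - \<alpha> *\<^sub>R w (Suc (Suc n))"
    by (rule y_Suc)
  also have "y (Suc (Suc n)) = (1 + \<beta>) *\<^sub>R y (Suc n) - \<alpha> *\<^sub>R H (y (Suc n)) - \<alpha> *\<^sub>R r - \<beta> *\<^sub>R y n"
    using ge2(2) by simp
  finally show ?case
    by (simp add: step y_Suc[of "Suc n"] y_Suc[of n] linear_diff[OF H] linear_add[OF H] linear_scale[OF H] algebra_simps)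
qed

lemma matrix_mul_matrix_inv:
  fixes A :: "real^'n^'n"
  assumes "\<And>v. A *v v = 0 \<Longrightarrow> v = 0"
  shows "A ** matrix_inv A = mat 1"
proof -
  have "\<exists>B. B ** A = mat 1"
    using assms matrix_left_invertible_ker[of A] by blast
  then have "\<exists>B. A ** B = mat 1 \<and> B ** A = mat 1"
    by (metis matrix_left_right_inverse)
  then show ?thesis
    unfolding matrix_inv_def by (rule someI2_ex) blast
qed

section \<open>Convergence of the forward and the reverse recursion\<close>

theorem mainTheorem6:
  fixes f :: "(real^'n) \<times> (real^'p) \<Rightarrow> real"
    and U :: "(real^'p) set"
    and eps m L :: "real^'p \<Rightarrow> real"
    and a r :: "real^'n"
    and u s :: "real^'p"
    and \<kappa> C \<alpha> \<beta> :: real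
    and K :: nat
    and x xh xt :: "int \<Rightarrow> real^'n"
    and ut :: "nat \<Rightarrow> real^'p"
    and R :: "real^'n^'n"
  assumes U: "open U" "U \<noteq> {}" "bounded U"
    and C2: "C2_on f (UNIV \<times> U)"
    and convex: "\<forall>u\<in>U. convex_on UNIV (\<lambda>x. f (x, u))"
    and unique_min: "\<forall>u\<in>U. \<exists>!x. is_arg_min (\<lambda>x. f (x, u)) (\<lambda>_. True) x"
    and posdef: "\<forall>u\<in>U. positive_definite (hess_x f (minimizer f u) u)"
    and eps_m_pos: "\<forall>u\<in>U. eps u > 0 \<and> m u > 0"
    and strong: "\<forall>u\<in>U. strongly_convex_on (cball (minimizer f u) (eps u)) (\<lambda>x. f (x, u)) (m u)"
    and a_level: "\<forall>u\<in>U. cball (minimizer f u) (eps u) \<subseteq> level_set f a u"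
    and L_pos: "\<forall>u\<in>U. L u > 0"
    and L_bound: "\<forall>u\<in>U. \<forall>x\<in>level_set f a u. \<forall>l. is_eigenvalue (hess_x f x u) l \<longrightarrow> l \<le> L u"
    and kappa_pos: "\<kappa> > 0"
    and kappa_bound: "\<forall>(x, u)\<in>level_graph f a U. onorm (\<lambda>h. grad_xu f x u *v h) \<le> \<kappa>"
    and C_nonneg: "C \<ge> 0"
    and lipschitz: "C-lipschitz_on (level_graph f a U) (D_grad_x f)"
    and u: "u \<in> U"
    and beta: "0 \<le> \<beta>" "\<beta> < 1"
    and alpha: "0 < \<alpha>" "\<alpha> \<le> 2 * (1 + \<beta>) / L u"
    and x_init: "x (-1) = a" "x 0 = a"
    and x_step: "\<forall>k::nat. x (int k + 1) =
       x (int k) - \<alpha> *\<^sub>R grad_x f (x (int k)) u + \<beta> *\<^sub>R (x (int k) - x (int k - 1))"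
    and K: "x (int K) \<in> cball (minimizer f u) (eps u)"
    and alpha_endpoint:
      "\<alpha> = 2 * (1 + \<beta>) / L u \<longrightarrow> \<not> is_eigenvalue (hess_x f (x (int K)) u) (L u)"
    and R: "R = (1 + \<beta>) *\<^sub>R mat 1 - \<alpha> *\<^sub>R hess_x f (x (int K)) u"
    and xh_init: "xh (-1) = 0" "xh 0 = 0"
    and xh_step: "\<forall>k::nat. xh (int k + 1) =
       R *v xh (int k) - \<alpha> *\<^sub>R (grad_xu f (x (int K)) u *v s) - \<beta> *\<^sub>R xh (int k - 1)"
    and xt_init: "xt (int K + 1) = 0" "xt (int K) = r"
    and xt_step: "\<forall>n::nat. xt (int K - int n - 1) =
       xt (int K - int n) v* R - \<beta> *\<^sub>R xt (int K - int n + 1)"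
    and ut_init: "ut 0 = 0"
    and ut_step: "\<forall>n. ut (Suc n) =
       ut n - \<alpha> *\<^sub>R (xt (int K - int n) v* grad_xu f (x (int K)) u)"
  shows "(\<lambda>k::nat. xh (int k)) \<longlonglongrightarrow> phi f (x (int K)) u *v s
    \<and> ut \<longlonglongrightarrow> r v* phi f (x (int K)) u
    \<and> (\<exists>q::real. 0 \<le> q \<and> q < 1 \<and>
        (\<forall>\<gamma>>0. \<exists>c::real. \<forall>k n :: nat.
           norm (xh (int k) - phi f (x (int K)) u *v s) \<le> c * (q + \<gamma>) ^ k * (\<kappa> / m u) * norm s \<and>
           norm (ut n - r v* phi f (x (int K)) u) \<le> c * (q + \<gamma>) ^ n * (\<kappa> / m u) * norm r))"
proof -
  define X where "X = x (int K)"
  define H where "H = hess_x f X u"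
  define B where "B = grad_xu f X u"
  define p where "p = phi f X u *v s"
  define p' where "p' = - (matrix_inv H *v r)"
  have "m u > 0" "eps u > 0" and "L u > 0"
    using u eps_m_pos L_pos by auto
  note grad = C2_on_grad_x[OF C2 u]
  have X: "X \<in> cball (minimizer f u) (eps u)"
    using K by (simp add: X_def)
  then have X_level: "X \<in> level_set f a u"
    using a_level u by blast
  have sym: "(H *v v) \<bullet> w = v \<bullet> (H *v w)" for v w
    unfolding H_def by (rule gradient_derivative_symmetric[OF grad])
  have coercive: "m u * (norm v)\<^sup>2 \<le> (H *v v) \<bullet> v" for v
    unfolding H_def using strong u \<open>eps u > 0\<close> X
    by (intro strongly_convex_on_cball_hessian[OF _ _ grad, of "minimizer f u" "eps u"]) auto
  have eig: "\<alpha> * l < 2 * (1 + \<beta>)" if "v \<noteq> 0" "H *v v = l *\<^sub>R v" for l v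
  proof -
    have l: "is_eigenvalue H l"
      using that by (auto simp: is_eigenvalue_def)
    then have "l \<le> L u"
      using L_bound u X_level by (simp add: H_def)
    moreover have "\<alpha> * L u \<le> 2 * (1 + \<beta>)"
      using alpha \<open>L u > 0\<close> by (simp add: pos_le_divide_eq)
    \<comment> \<open>Strictness comes from \<open>l < L u\<close> and \<alpha> > 0 in general; for
      \<open>l = L u\<close> it comes from \<open>alpha_endpoint\<close>, which rules out the
      extreme step size.\<close>
    moreover have "\<alpha> * L u < 2 * (1 + \<beta>)" if "l = L u"
    proof -
      have "\<alpha> \<noteq> 2 * (1 + \<beta>) / L u"
        using alpha_endpoint l that by (auto simp: H_def X_def)
      then show ?thesis
        using alpha \<open>L u > 0\<close> by (simp add: pos_less_divide_eq[symmetric])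
    qed
    ultimately show ?thesis
      using alpha(1) by (cases "l = L u") (auto intro: less_le_trans[of _ "\<alpha> * L u"])
  qed
  obtain q c :: real where q: "0 \<le> q" "q < 1" and c: "0 \<le> c"
    and solver: "\<And>z b p k. \<lbrakk>\<And>k. z (Suc (Suc k)) =
        (1 + \<beta>) *\<^sub>R z (Suc k) - \<alpha> *\<^sub>R (H *v z (Suc k)) - \<alpha> *\<^sub>R b - \<beta> *\<^sub>R z k;
      z 0 = 0; z (Suc 0) = 0; H *v p = - b\<rbrakk> \<Longrightarrow> norm (z (Suc k) - p) \<le> c * q ^ k * (norm b / m u)"
    by (rule heavy_ball_linear_solver[OF matrix_vector_mul_linear[of H] sym \<open>m u > 0\<close> coercive alpha(1) beta])
      (use eig in blast)+
  have R_eq: "R *v v = (1 + \<beta>) *\<^sub>R v - \<alpha> *\<^sub>R (H *v v)" for v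
    by (simp add: R H_def X_def matrix_vector_mult_diff_rdistrib flip: scaleR_matrix_vector_assoc)
  \<comment> \<open>Since \<open>R\<close> is symmetric, the row recursion of the adjoints is the
    same iteration as the column recursion.\<close>
  have vR_eq: "v v* R = (1 + \<beta>) *\<^sub>R v - \<alpha> *\<^sub>R (H *v v)" for v
  proof (rule vector_eq_rdot[THEN iffD1], rule allI)
    fix w
    show "(v v* R) \<bullet> w = ((1 + \<beta>) *\<^sub>R v - \<alpha> *\<^sub>R (H *v v)) \<bullet> w"
      by (simp add: dot_lmul_matrix R_eq inner_diff_left inner_diff_right sym)
  qed
  have inv: "H ** matrix_inv H = mat 1"
  proof (rule matrix_mul_matrix_inv)
    fix v assume "H *v v = 0"
    then show "v = 0"
      using coercive[of v] \<open>m u > 0\<close> by (simp add: mult_le_0_iff)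
  qed
  have phi_mult: "phi f X u *v w = - (matrix_inv H *v (B *v w))" for w
    \<comment> \<open>The instance with 0 serves as the rule for the product of a negated matrix
      with a vector.\<close>
    using matrix_vector_mult_diff_rdistrib[of 0 "matrix_inv H ** B" w]
    by (simp add: phi_def H_def B_def matrix_vector_mul_assoc)
  have Hp: "H *v p = - (B *v s)"
    by (simp add: p_def phi_mult linear_neg[OF matrix_vector_mul_linear] matrix_vector_mul_assoc matrix_mul_assoc inv)
  have Hp': "H *v p' = - r"
    by (simp add: p'_def linear_neg[OF matrix_vector_mul_linear] matrix_vector_mul_assoc inv)
  \<comment> \<open>Symmetry of \<open>H\<close> lets the inverse act on \<open>r\<close> instead,
    so the reverse limit is the solution \<open>p'\<close> of a system with right-hand side
    \<open>r\<close>, multiplied by \<open>B\<close> at the end.\<close>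
  have r_phi: "r v* phi f X u = p' v* B"
  proof (rule vector_eq_rdot[THEN iffD1], rule allI)
    fix w
    have "(r v* phi f X u) \<bullet> w = (H *v p') \<bullet> (matrix_inv H *v (B *v w))"
      by (simp add: dot_lmul_matrix phi_mult Hp')
    also have "\<dots> = p' \<bullet> (B *v w)"
      by (simp only: sym matrix_vector_mul_assoc matrix_mul_assoc inv matrix_mul_lid)
    finally show "(r v* phi f X u) \<bullet> w = (p' v* B) \<bullet> w"
      by (simp add: dot_lmul_matrix)
  qed
  have B_bound: "onorm ((*v) B) \<le> \<kappa>"
    using kappa_bound u X_level by (auto simp: level_graph_def B_def)

  have xh_bound: "norm (xh (int k) - p) \<le> c * q ^ k * (\<kappa> / m u * norm s)" for k
  proof -
    \<comment> \<open>The shift turns the indices -1 and 0 of the forward recursion into 0 and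
      1.\<close>
    define z where "z k = xh (int k - 1)" for k
    have "z (Suc (Suc k)) = (1 + \<beta>) *\<^sub>R z (Suc k) - \<alpha> *\<^sub>R (H *v z (Suc k)) - \<alpha> *\<^sub>R (B *v s) - \<beta> *\<^sub>R z k" for k
      using xh_step[rule_format, of k] by (simp add: z_def R_eq B_def X_def add.commute)
    moreover have "z 0 = 0" "z (Suc 0) = 0"
      by (simp_all add: z_def xh_init)
    ultimately have "norm (z (Suc k) - p) \<le> c * q ^ k * (norm (B *v s) / m u)"
      using Hp by (rule solver)
    also have "\<dots> \<le> c * q ^ k * (\<kappa> * norm s / m u)"
      using q c \<open>m u > 0\<close> B_bound
      by (intro mult_left_mono divide_right_mono order_trans[OF onorm] mult_right_mono) auto
    finally show ?thesis
      by (simp add: z_def)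
  qed

  have ut_bound: "norm (ut n - r v* phi f X u) \<le> c * q ^ n * (\<kappa> / m u * norm r)" for n
  proof -
    define w where "w n = xt (int K - int n)" for n
    define y where "y n = (\<Sum>j<n. - \<alpha> *\<^sub>R w j)" for n
    \<comment> \<open>Truncated subtraction gives \<open>z 0 = z 1 = y 0 = 0\<close>, the two zero
      starting values that \<open>solver\<close> expects.\<close>
    define z where "z n = y (n - 1)" for n
    \<comment> \<open>The fixed factor \<open>B\<close> comes out of the sum of the adjoints, so
      convergence of \<open>y\<close> to \<open>p'\<close> is enough.\<close>
    have ut: "ut n = y n v* B" for n
      by (induction n) (simp_all add: ut_init ut_step y_def w_def B_def X_def
          vector_matrix_mult_diff_distrib scaleR_vector_matrix_assoc)
    have w_step: "w (Suc (Suc n)) = (1 + \<beta>) *\<^sub>R w (Suc n) - \<alpha> *\<^sub>R (H *v w (Suc n)) - \<beta> *\<^sub>R w n" for n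
      using xt_step[rule_format, of "Suc n"] by (simp add: w_def vR_eq algebra_simps)
    have w_1: "w (Suc 0) = (1 + \<beta>) *\<^sub>R r - \<alpha> *\<^sub>R (H *v r)"
      using xt_step[rule_format, of 0] by (simp add: w_def vR_eq xt_init)
    have "w 0 = r"
      by (simp add: w_def xt_init)
    then have "z (Suc (Suc n)) = (1 + \<beta>) *\<^sub>R z (Suc n) - \<alpha> *\<^sub>R (H *v z (Suc n)) - \<alpha> *\<^sub>R r - \<beta> *\<^sub>R z n" for n
      using heavy_ball_partial_sums[OF matrix_vector_mul_linear _ w_1 w_step y_def, of n]
      by (simp add: z_def)
    moreover have "z 0 = 0" "z (Suc 0) = 0"
      by (simp_all add: z_def y_def)
    ultimately have *: "norm (z (Suc n) - p') \<le> c * q ^ n * (norm r / m u)"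
      using Hp' by (rule solver)
    have "norm (ut n - r v* phi f X u) = norm ((z (Suc n) - p') v* B)"
      by (simp add: ut r_phi z_def vector_matrix_mult_diff_distrib)
    also have "\<dots> \<le> \<kappa> * norm (z (Suc n) - p')"
      by (rule norm_vector_matrix_mult_le[OF B_bound])
    also have "\<dots> \<le> \<kappa> * (c * q ^ n * (norm r / m u))"
      using * kappa_pos by (intro mult_left_mono) auto
    finally show ?thesis
      by (simp add: mult_ac)
  qed

  have lim0: "(\<lambda>n. c * q ^ n * d) \<longlonglongrightarrow> 0" for d
    using q by (intro tendsto_mult_left_zero tendsto_mult_right_zero LIMSEQ_power_zero) auto
  have xh_lim: "(\<lambda>k::nat. xh (int k)) \<longlonglongrightarrow> p"
    by (rule LIM_zero_cancel, rule Lim_null_comparison[OF always_eventually lim0]) (use xh_bound in blast)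
  have ut_lim: "ut \<longlonglongrightarrow> r v* phi f X u"
    by (rule LIM_zero_cancel, rule Lim_null_comparison[OF always_eventually lim0]) (use ut_bound in blast)
  have bounds: "\<forall>\<gamma>>0. \<exists>c::real. \<forall>k n :: nat.
      norm (xh (int k) - p) \<le> c * (q + \<gamma>) ^ k * (\<kappa> / m u) * norm s \<and>
      norm (ut n - r v* phi f X u) \<le> c * (q + \<gamma>) ^ n * (\<kappa> / m u) * norm r"
  \<comment> \<open>The constant of \<open>solver\<close> serves every \<gamma>, since
    \<open>q ^ j \<le> (q + \<gamma>) ^ j\<close>.\<close>
  proof (intro allI impI, rule exI[of _ c], intro allI)
    fix \<gamma> :: real and k n :: nat
    assume "\<gamma> > 0"
    have weaken: "c * q ^ j * (\<kappa> / m u * d) \<le> c * (q + \<gamma>) ^ j * (\<kappa> / m u) * d" if "d \<ge> 0" for j d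
      unfolding mult.assoc[of _ "\<kappa> / m u"]
      using q c \<open>\<gamma> > 0\<close> kappa_pos \<open>m u > 0\<close> that
      by (intro mult_right_mono mult_left_mono power_mono) auto
    show "norm (xh (int k) - p) \<le> c * (q + \<gamma>) ^ k * (\<kappa> / m u) * norm s \<and>
      norm (ut n - r v* phi f X u) \<le> c * (q + \<gamma>) ^ n * (\<kappa> / m u) * norm r"
      by (intro conjI order_trans[OF xh_bound weaken] order_trans[OF ut_bound weaken] norm_ge_zero)
  qed
  show ?thesis
    unfolding X_def[symmetric] p_def[symmetric]
    by (intro conjI exI[of _ q]) (fact xh_lim ut_lim q bounds)+
qed

end
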